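(* Let $X$ be a measurable space. Then $\mathrm{Iso}(X) = \mathrm{bij}(X)$ if and only if $X$ is cocardinal.
   Context: A measurable space is a set $X$ equipped with a $\sigma$-algebra $\Sigma$. $\mathrm{Iso}(X)$ is the set of all measurable maps from $X$ to $X$ that are bijective with measurable inverse, and $\mathrm{bij}(X)$ is the set of all bijective maps from $X$ to $X$. For a cardinal number $\kappa$, the $\kappa$-co-$\kappa$ algebra on $X$ is the $\sigma$-algebra whose measurable sets are exactly the subsets of $X$ that have cardinality (strictly) less than $\kappa$ or whose complement in $X$ has cardinality (strictly) less than $\kappa$. The $\kappa$-co-$\kappa$ algebra is not defined for $1 < \kappa \leqslant \aleph_0$, so these values of $\kappa$ are excluded. The $1$-co-$1$ algebra is the trivial $\sigma$-algebra $\{\emptyset, X\}$, and the $\kappa$-co-$\kappa$ algebra is the discrete $\sigma$-algebra (all subsets of $X$) if $\kappa$ is bigger than the cardinality of $X$. A measurable space $(X,\Sigma)$ is called cocardinal if there is a cardinal $\kappa$ such that $\Sigma$ is the $\kappa$-co-$\kappa$ algebra on $X$. *)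

theory Defs
  imports "HOL-Analysis.Sigma_Algebra" "HOL-Algebra.Bij"
begin

unbundle cardinal_syntax

text \<open>
  A measurable space is represented by an element of type \<open>'a measure\<close>, of which only \<open>space\<close>
  and \<open>sets\<close> are used; every sigma-algebra on a subset of \<open>'a\<close> arises in this way. The set of all
  bijections of \<open>X\<close> is \<open>Bij X\<close>, whose elements are extensional, that is, they take the value
  \<open>undefined\<close> outside \<open>X\<close>, so that they correspond one-to-one to the maps from \<open>X\<close> to \<open>X\<close>.
\<close>

definition Iso :: "'a measure \<Rightarrow> ('a \<Rightarrow> 'a) set" where
  "Iso M = {f \<in> Bij (space M). f \<in> M \<rightarrow>\<^sub>M M \<and> inv_into (space M) f \<in> M \<rightarrow>\<^sub>M M}"

text \<open>
  As in the library, a cardinal is a relation \<open>\<kappa>\<close> with \<open>Card_order \<kappa>\<close>.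
\<close>

definition co_card_algebra :: "'k rel \<Rightarrow> 'a set \<Rightarrow> 'a set set" where
  "co_card_algebra \<kappa> X = {A. A \<subseteq> X \<and> ( |A| <o \<kappa> \<or> |X - A| <o \<kappa> )}"

text \<open>
  The cardinals for which the algebra is considered: those with \<open>1 < \<kappa> \<le> \<aleph>\<^sub>0\<close> are excluded. For
  \<open>\<kappa> = 0\<close> the collection is empty and hence is not the family of measurable sets of any space.
\<close>

definition admissible_cardinal :: "'k rel \<Rightarrow> bool" where
  "admissible_cardinal \<kappa> \<longleftrightarrow> Card_order \<kappa> \<and> \<not> (cone <o \<kappa> \<and> \<kappa> \<le>o natLeq)"

text \<open>
  HOL cannot quantify over cardinals on arbitrary types inside a formula. The type
  \<open>(nat + 'a) set\<close> carries an uncountable cardinal and one larger than any subset of \<open>'a\<close>; the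
  lemma \<open>cocardinalI\<close> below shows that cardinals on other types add nothing.
\<close>

definition cocardinal :: "'a measure \<Rightarrow> bool" where
  "cocardinal M \<longleftrightarrow>
     (\<exists>\<kappa> :: (nat + 'a) set rel.
        admissible_cardinal \<kappa> \<and> sets M = co_card_algebra \<kappa> (space M))"

lemma co_card_algebra_one:
  fixes X :: "'a set"
  shows "co_card_algebra cone X = {{}, X}"
proof -
  have *: "|A| <o cone \<longleftrightarrow> A = {}" for A :: "'a set"
    unfolding cone_def card_of_ordLess[symmetric]
    by (auto simp: inj_on_def)
  show ?thesis
    unfolding co_card_algebra_def * by auto
qed

lemma co_card_algebra_discrete:
  assumes "|X| <o \<kappa>"
  shows "co_card_algebra \<kappa> X = Pow X"
proof -
  have "|A| <o \<kappa>" if "A \<subseteq> X" for A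
    by (rule ordLeq_ordLess_trans[OF card_of_mono1[OF that] assms])
  then show ?thesis
    unfolding co_card_algebra_def by auto
qed

lemma co_card_algebra_cong:
  fixes \<kappa> :: "'k rel" and \<kappa>' :: "'l rel" and X :: "'a set"
  assumes "\<kappa> =o \<kappa>'"
  shows "co_card_algebra \<kappa> X = co_card_algebra \<kappa>' X"
proof -
  have "|A| <o \<kappa> \<longleftrightarrow> |A| <o \<kappa>'" for A :: "'a set"
    using ordLess_ordIso_trans[OF _ assms] ordLess_ordIso_trans[OF _ ordIso_symmetric[OF assms]]
    by blast
  then show ?thesis
    by (simp add: co_card_algebra_def)
qed

lemma admissible_cardinal_cong:
  assumes "\<kappa> =o \<kappa>'" "admissible_cardinal \<kappa>"
  shows "admissible_cardinal \<kappa>'"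
  using assms(2) Card_order_ordIso2[OF _ assms(1)] ordIso_ordLeq_trans[OF assms(1)]
    ordLess_ordIso_trans[OF _ ordIso_symmetric[OF assms(1)]]
  unfolding admissible_cardinal_def by blast

lemma cocardinalI:
  fixes M :: "'a measure" and \<kappa> :: "'k rel"
  assumes \<kappa>: "admissible_cardinal \<kappa>" and M: "sets M = co_card_algebra \<kappa> (space M)"
  shows "cocardinal M"
proof -
  let ?U = "UNIV :: (nat + 'a) set set"
  have card: "Card_order \<kappa>"
    using \<kappa> by (simp add: admissible_cardinal_def)
  consider "\<kappa> \<le>o |?U|" | "|?U| <o \<kappa>"
    using ordLess_or_ordLeq[OF card_of_Well_order card_order_on_well_order_on[OF card]] by blast
  then show ?thesis
  proof cases
    case 1
    have "|Field \<kappa>| \<le>o |?U|"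
      by (rule ordIso_ordLeq_trans[OF card_of_Field_ordIso[OF card] 1])
    then obtain B :: "(nat + 'a) set set" where "|Field \<kappa>| =o |B|"
      by (auto dest: internalize_card_of_ordLeq2[THEN iffD1])
    then have iso: "\<kappa> =o |B|"
      by (rule ordIso_transitive[OF ordIso_symmetric[OF card_of_Field_ordIso[OF card]]])
    show ?thesis
      unfolding cocardinal_def
      using admissible_cardinal_cong[OF iso \<kappa>] M co_card_algebra_cong[OF iso] by blast
  next
    case 2
    have big: "|UNIV :: (nat + 'a) set| <o |?U|"
      using card_of_Pow[of "UNIV :: (nat + 'a) set"] by simp
    have "|space M| \<le>o |UNIV :: (nat + 'a) set|"
      by (rule card_of_ordLeqI[of Inr]) auto
    then have X: "|space M| <o |?U|"
      using big by (rule ordLeq_ordLess_trans)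
    have "|UNIV :: nat set| \<le>o |UNIV :: (nat + 'a) set|"
      by (rule card_of_ordLeqI[of Inl]) auto
    then have "natLeq <o |?U|"
      by (rule ordLeq_ordLess_trans[OF ordIso_ordLeq_trans[OF ordIso_symmetric[OF card_of_nat]] big])
    then have "admissible_cardinal |?U|"
      using not_ordLess_ordLeq[of natLeq "|?U|"] card_of_Card_order[of ?U]
      unfolding admissible_cardinal_def by blast
    moreover have "sets M = co_card_algebra |?U| (space M)"
      using M co_card_algebra_discrete[OF X] co_card_algebra_discrete[of "space M" \<kappa>]
        ordLess_transitive[OF X 2] by simp
    ultimately show ?thesis
      unfolding cocardinal_def by blast
  qed
qed

end

theory Submission
  imports Defs
begin

text \<open>
  A \<open>\<sigma>\<close>-algebra invariant under all bijections is studied by means of involutions. If it contains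
  \<open>A\<close>, and \<open>C \<subseteq> A\<close> and \<open>D \<subseteq> X - A\<close> are equipotent, then exchanging \<open>C\<close> and \<open>D\<close> shows that it
  contains \<open>C\<close>. With one-point sets this gives all countable sets as soon as the algebra is not
  trivial. If it is moreover not discrete, let \<open>\<kappa>\<close> be the least cardinality of a non-measurable
  set \<open>B\<close>. A measurable \<open>A\<close> such that \<open>A\<close> and \<open>X - A\<close> both have at least \<open>\<kappa>\<close> elements would yield
  a measurable \<open>C\<close> of cardinality \<open>\<kappa>\<close> whose complement is equipotent to \<open>X\<close>; but \<open>B\<close> is the union of
  two images of \<open>C\<close> under bijections of \<open>X\<close>.
\<close>

section \<open>Invariance of the algebra under bijections\<close>

definition bij_invariant :: "'a measure \<Rightarrow> bool" where
  "bij_invariant M \<longleftrightarrow>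
     (\<forall>f A. bij_betw f (space M) (space M) \<longrightarrow> A \<in> sets M \<longrightarrow> f ` A \<in> sets M)"

lemma vimage_eq_image_inv_into:
  assumes "bij_betw f X Y" "A \<subseteq> Y"
  shows "f -` A \<inter> X = inv_into X f ` A"
  using assms unfolding bij_betw_def
  by (auto simp: inv_into_into f_inv_into_f inv_into_f_f intro!: image_eqI[where x = "f _"])

text \<open>Preimages under a bijection are images under its inverse, which is again a
  bijection.\<close>

lemma Iso_eq_Bij_iff_bij_invariant: "Iso M = Bij (space M) \<longleftrightarrow> bij_invariant M"
proof
  assume eq: "Iso M = Bij (space M)"
  show "bij_invariant M"
    unfolding bij_invariant_def
  proof (intro allI impI)
    fix f A
    assume f: "bij_betw f (space M) (space M)" and A: "A \<in> sets M"
    \<comment> \<open>Elements of \<open>Bij\<close> are extensional, while \<open>f\<close> is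
      arbitrary outside the space.\<close>
    define h where "h = restrict f (space M)"
    have h: "bij_betw h (space M) (space M)"
      using f unfolding h_def by (simp cong: bij_betw_cong)
    then have "h \<in> Iso M"
      unfolding eq Bij_def h_def by simp
    then have "inv_into (space M) h \<in> M \<rightarrow>\<^sub>M M"
      by (simp add: Iso_def)
    then have "inv_into (space M) h -` A \<inter> space M \<in> sets M"
      using A by (rule measurable_sets)
    also have "inv_into (space M) h -` A \<inter> space M = h ` A"
      using vimage_eq_image_inv_into[OF bij_betw_inv_into[OF h] sets.sets_into_space[OF A]]
        inv_into_inv_into_eq[OF h] sets.sets_into_space[OF A]
      by (metis (no_types, lifting) image_cong subsetD)
    also have "\<dots> = f ` A"
      using sets.sets_into_space[OF A] by (auto simp: h_def)
    finally show "f ` A \<in> sets M" .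
  qed
next
  assume inv: "bij_invariant M"
  have meas: "f \<in> M \<rightarrow>\<^sub>M M" if f: "bij_betw f (space M) (space M)" for f
  proof (rule measurableI)
    show "f x \<in> space M" if "x \<in> space M" for x
      using f that by (rule bij_betwE[THEN bspec])
    show "f -` A \<inter> space M \<in> sets M" if A: "A \<in> sets M" for A
      unfolding vimage_eq_image_inv_into[OF f sets.sets_into_space[OF A]]
      using inv A bij_betw_inv_into[OF f] unfolding bij_invariant_def by blast
  qed
  show "Iso M = Bij (space M)"
    unfolding Iso_def using meas bij_betw_inv_into by (auto simp: Bij_def)
qed

text \<open>Gluing a bijection from \<open>A\<close> to \<open>B\<close> with one between the
  complements gives a bijection of the whole space. From here on only cardinalities have to be
  compared.\<close>

lemma bij_invariantD:
  assumes "bij_invariant M" "A \<in> sets M" "B \<subseteq> space M"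
    and "|A| =o |B|" "|space M - A| =o |space M - B|"
  shows "B \<in> sets M"
proof -
  obtain f g where f: "bij_betw f A B" and g: "bij_betw g (space M - A) (space M - B)"
    using assms(4,5) by (auto simp: card_of_ordIso[symmetric])
  define h where "h = (\<lambda>x. if x \<in> A then f x else g x)"
  have "bij_betw h (A \<union> (space M - A)) (B \<union> (space M - B))"
    unfolding h_def by (rule bij_betw_disjoint_Un[OF f g]) auto
  then have "bij_betw h (space M) (space M)"
    using sets.sets_into_space[OF assms(2)] assms(3) by (simp add: Un_absorb1)
  moreover have "h ` A = B"
    using f by (simp add: h_def bij_betw_def)
  ultimately show ?thesis
    using assms(1,2) unfolding bij_invariant_def by blast
qed

lemma cocardinal_imp_bij_invariant:
  assumes "cocardinal M"
  shows "bij_invariant M"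
proof -
  obtain \<kappa> :: "(nat + 'a) set rel" where M: "sets M = co_card_algebra \<kappa> (space M)"
    using assms unfolding cocardinal_def by blast
  show ?thesis
    unfolding bij_invariant_def
  proof (intro allI impI)
    fix f A
    assume f: "bij_betw f (space M) (space M)" and A: "A \<in> sets M"
    have sub: "A \<subseteq> space M"
      using A by (rule sets.sets_into_space)
    have inj: "inj_on f (space M)" and img: "f ` space M = space M"
      using f by (auto simp: bij_betw_def)
    have "space M - f ` A = f ` (space M - A)"
      using inj_on_image_set_diff[OF inj _ sub, of "space M"] img by simp
    then have "|f ` A| \<le>o |A|" "|space M - f ` A| \<le>o |space M - A|"
      by (simp_all add: card_of_image)
    moreover have "|A| <o \<kappa> \<or> |space M - A| <o \<kappa>"
      using A unfolding M co_card_algebra_def by blast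
    ultimately have "|f ` A| <o \<kappa> \<or> |space M - f ` A| <o \<kappa>"
      using ordLeq_ordLess_trans by blast
    moreover have "f ` A \<subseteq> space M"
      using sub img by blast
    ultimately show "f ` A \<in> sets M"
      unfolding M co_card_algebra_def by blast
  qed
qed

section \<open>Cardinal arithmetic of sets\<close>

lemma card_of_disjoint_Un_cong:
  assumes "|A| =o |C|" "|B| =o |D|" "A \<inter> B = {}" "C \<inter> D = {}"
  shows "|A \<union> B| =o |C \<union> D|"
  using assms bij_betw_disjoint_Un unfolding card_of_ordIso[symmetric] by blast

text \<open>\<open>X - C\<close> must be infinite, and an infinite set absorbs the union with a set
  that is not larger.\<close>

lemma card_of_Diff_infinite:
  assumes "infinite X" "C \<subseteq> X" "|C| \<le>o |X - C|"
  shows "|X - C| =o |X|"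
proof -
  have X: "X = (X - C) \<union> C"
    using assms(2) by blast
  then have "infinite (X - C)"
    using assms(1,3) card_of_ordLeq_finite by (metis finite_Un)
  then have "|(X - C) <+> C| =o |X - C|"
    using card_of_Plus_infinite1 assms(3) by blast
  then have "|(X - C) \<union> C| \<le>o |X - C|"
    by (rule ordLeq_ordIso_trans[OF card_of_Un_Plus_ordLeq])
  then have "|X| \<le>o |X - C|"
    using X by simp
  then show ?thesis
    by (simp add: ordIso_iff_ordLeq card_of_mono1)
qed

text \<open>The halves are the images of the two summands under a bijection from
  \<open>B <+> B\<close> to \<open>B\<close>.\<close>

lemma infinite_halves:
  assumes "infinite B"
  obtains B1 B2 where "B = B1 \<union> B2" "B1 \<inter> B2 = {}" "|B1| =o |B|" "|B2| =o |B|"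
proof -
  have "|B <+> B| =o |B|"
    by (rule card_of_Plus_infinite1[OF assms card_of_mono1]) simp
  then obtain h where h: "bij_betw h (B <+> B) B"
    by (auto simp: card_of_ordIso[symmetric])
  then have inj: "inj_on h (B <+> B)" and img: "h ` (B <+> B) = B"
    by (auto simp: bij_betw_def)
  have "B = h ` Inl ` B \<union> h ` Inr ` B"
    using img by (auto simp: Plus_def image_Un)
  moreover have "h ` Inl ` B \<inter> h ` Inr ` B = {}"
    using inj by (auto dest: inj_onD)
  moreover have "bij_betw (h \<circ> Inl) B (h ` Inl ` B)" "bij_betw (h \<circ> Inr) B (h ` Inr ` B)"
    using inj by (auto simp: bij_betw_def inj_on_def)
  then have "|h ` Inl ` B| =o |B|" "|h ` Inr ` B| =o |B|"
    by (blast intro: card_of_ordIsoI ordIso_symmetric)+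
  ultimately show ?thesis
    by (rule that)
qed

lemma card_of_ordLeq_subset:
  assumes "|B| \<le>o |A|"
  obtains C where "C \<subseteq> A" "|C| =o |B|"
proof -
  obtain f where f: "inj_on f B" "f ` B \<subseteq> A"
    using assms by (auto simp: card_of_ordLeq[symmetric])
  then have "|f ` B| =o |B|"
    by (metis bij_betw_imageI card_of_ordIsoI ordIso_symmetric)
  with f(2) show ?thesis
    by (rule that)
qed

section \<open>Measurable sets of an invariant algebra\<close>

lemma bij_invariant_exchange:
  assumes inv: "bij_invariant M" and A: "A \<in> sets M"
    and C: "C \<subseteq> A" and D: "D \<subseteq> space M - A" and CD: "|C| =o |D|"
  shows "C \<in> sets M"
proof -
  have AM: "A \<subseteq> space M"
    using A by (rule sets.sets_into_space)
  \<comment> \<open>The image of \<open>A\<close> under the exchange of \<open>C\<close> and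
    \<open>D\<close>. The exchange need not be written down, since the cardinalities of
    \<open>?A'\<close> and its complement suffice; \<open>C\<close> is then recovered as
    \<open>A - ?A'\<close>.\<close>
  let ?A' = "(A - C) \<union> D"
  have "|(A - C) \<union> C| =o |(A - C) \<union> D|"
    using CD C D by (intro card_of_disjoint_Un_cong) (auto simp: card_of_refl)
  moreover have "(A - C) \<union> C = A"
    using C by blast
  ultimately have card_A: "|A| =o |?A'|"
    by simp
  have "|(space M - A - D) \<union> D| =o |(space M - A - D) \<union> C|"
    using ordIso_symmetric[OF CD] C D by (intro card_of_disjoint_Un_cong) (auto simp: card_of_refl)
  moreover have "(space M - A - D) \<union> D = space M - A" "(space M - A - D) \<union> C = space M - ?A'"
    using C D AM by auto
  ultimately have card_compl: "|space M - A| =o |space M - ?A'|"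
    by simp
  have "?A' \<subseteq> space M"
    using AM D by blast
  then have "?A' \<in> sets M"
    by (rule bij_invariantD[OF inv A _ card_A card_compl])
  then have "A - ?A' \<in> sets M"
    by (rule sets.Diff[OF A])
  moreover have "A - ?A' = C"
    using C D by blast
  ultimately show ?thesis
    by simp
qed

lemma bij_invariant_countable:
  assumes inv: "bij_invariant M" and nontriv: "sets M \<noteq> {{}, space M}"
    and B: "countable B" "B \<subseteq> space M"
  shows "B \<in> sets M"
proof -
  obtain A where A: "A \<in> sets M" "A \<noteq> {}" "A \<noteq> space M"
    using nontriv by auto
  then have AM: "A \<subseteq> space M"
    by (intro sets.sets_into_space)
  obtain a b where ab: "a \<in> A" "b \<in> space M - A"
    using A AM by blast
  have single: "|{x}| =o |{y}|" for x y :: 'a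
    by (rule card_of_ordIsoI[of "\<lambda>_. y"]) (simp add: bij_betw_def)
  \<comment> \<open>Exchange the point \<open>a\<close> of \<open>A\<close> with the point
    \<open>b\<close> outside.\<close>
  have a: "{a} \<in> sets M"
    using ab by (auto intro: bij_invariant_exchange[OF inv A(1) _ _ single[of a b]])
  have singleton: "{x} \<in> sets M" if x: "x \<in> space M" for x
  proof (rule bij_invariantD[OF inv a _ single])
    \<comment> \<open>The transposition of \<open>a\<close> and \<open>x\<close>, seen on the
      complement of \<open>{a}\<close>.\<close>
    have "bij_betw (\<lambda>y. if y = x then a else y) (space M - {a}) (space M - {x})"
      if "x \<noteq> a"
      using x ab AM that by (auto simp: bij_betw_def inj_on_def image_iff)
    then show "|space M - {a}| =o |space M - {x}|"
      by (cases "x = a") (auto intro: card_of_ordIsoI)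
  qed (use x in simp)
  show ?thesis
    by (rule sets.countable[OF singleton B(1)]) (use B(2) in blast)
qed

text \<open>Cardinals are well-ordered. The minimum is given as a set \<open>B\<close>, so that
  \<open>|B|\<close> itself can serve as the cardinal of the algebra.\<close>

lemma minimal_cardinality:
  assumes "P (B0 :: 'a set)"
  obtains B where "P B" "\<And>A :: 'a set. |A| <o |B| \<Longrightarrow> \<not> P A"
proof -
  have "wf (inv_image ordLess (card_of :: 'a set \<Rightarrow> 'a rel))"
    by (rule wf_inv_image[OF wf_ordLess])
  then obtain B where "B \<in> Collect P"
    and "\<And>A. (A, B) \<in> inv_image ordLess card_of \<Longrightarrow> A \<notin> Collect P"
    using wfE_min[of _ B0 "Collect P"] assms by (metis mem_Collect_eq)
  then show ?thesis
    using that by (simp add: inv_image_def)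
qed

lemma bij_invariant_imp_small:
  assumes inv: "bij_invariant M" and B: "B \<subseteq> space M" "B \<notin> sets M" "infinite B"
    and A: "A \<in> sets M"
  shows "|A| <o |B| \<or> |space M - A| <o |B|"
proof (rule ccontr)
  assume "\<not> ?thesis"
  then have "|B| \<le>o |A|" "|B| \<le>o |space M - A|"
    using ordLess_or_ordLeq[OF card_of_Well_order card_of_Well_order] by blast+
  then obtain C D where C: "C \<subseteq> A" "|C| =o |B|" and D: "D \<subseteq> space M - A" "|D| =o |B|"
    by (metis card_of_ordLeq_subset)
  have CD: "|C| =o |D|"
    using C(2) ordIso_symmetric[OF D(2)] by (rule ordIso_transitive)
  have Cm: "C \<in> sets M"
    using inv A C(1) D(1) CD by (rule bij_invariant_exchange)
  have inf: "infinite (space M)"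
    using B(1,3) finite_subset by blast
  \<comment> \<open>The copy \<open>F\<close> of \<open>E\<close> in its complement shows that the
    complement is at least as large as \<open>E\<close>.\<close>
  have compl: "|space M - E| =o |space M|"
    if "E \<subseteq> space M" "F \<subseteq> space M - E" "|E| =o |F|" for E F
    using that by (intro card_of_Diff_infinite[OF inf])
      (auto intro: ordIso_ordLeq_trans card_of_mono1)
  have C_compl: "|space M - C| =o |space M|"
    using sets.sets_into_space[OF Cm] C(1) D(1) CD by (intro compl[of C D]) auto
  \<comment> \<open>\<open>B\<close> itself may have a small complement, so it need not be an image
    of \<open>C\<close>. Each half of \<open>B\<close> has the other as a disjoint copy, so its
    complement is as large as that of \<open>C\<close>.\<close>
  have half: "E \<in> sets M"
    if "E \<subseteq> space M" "F \<subseteq> space M" "E \<inter> F = {}" "|E| =o |B|" "|F| =o |B|" for E F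
  proof (rule bij_invariantD[OF inv Cm that(1)])
    show "|C| =o |E|"
      using C(2) ordIso_symmetric[OF that(4)] by (rule ordIso_transitive)
    have "|space M - E| =o |space M|"
      using that ordIso_transitive[OF that(4) ordIso_symmetric[OF that(5)]]
      by (intro compl[of E F]) auto
    then show "|space M - C| =o |space M - E|"
      using C_compl ordIso_symmetric ordIso_transitive by blast
  qed
  obtain B1 B2 where "B = B1 \<union> B2" "B1 \<inter> B2 = {}" "|B1| =o |B|" "|B2| =o |B|"
    using B(3) by (rule infinite_halves)
  then have "B \<in> sets M"
    using half[of B1 B2] half[of B2 B1] B(1) by (auto simp: Int_commute)
  with B(2) show False
    by blast
qed

section \<open>From invariance to cocardinality\<close>

lemma cocardinal_trivial:
  assumes "sets M = {{}, space M}"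
  shows "cocardinal M"
proof (rule cocardinalI[of cone])
  show "admissible_cardinal cone"
    unfolding admissible_cardinal_def using Card_order_cone ordLess_irreflexive by blast
qed (simp add: assms co_card_algebra_one)

lemma cocardinal_discrete:
  assumes "sets M = Pow (space M)"
  shows "cocardinal (M :: 'a measure)"
proof (rule cocardinalI)
  \<comment> \<open>By Cantor this exceeds both \<open>natLeq\<close>, so it is admissible, and
    \<open>|space M|\<close>, so the algebra is discrete.\<close>
  let ?\<kappa> = "|UNIV :: (nat + 'a) set set|"
  have big: "|UNIV :: (nat + 'a) set| <o ?\<kappa>"
    using card_of_Pow[of "UNIV :: (nat + 'a) set"] by simp
  have "|UNIV :: nat set| \<le>o |UNIV :: (nat + 'a) set|"
    by (rule card_of_ordLeqI[of Inl]) auto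
  then have "natLeq <o ?\<kappa>"
    by (rule ordLeq_ordLess_trans[OF ordIso_ordLeq_trans[OF ordIso_symmetric[OF card_of_nat]] big])
  then show "admissible_cardinal ?\<kappa>"
    unfolding admissible_cardinal_def using not_ordLess_ordLeq card_of_Card_order by blast
  have "|space M| \<le>o |UNIV :: (nat + 'a) set|"
    by (rule card_of_ordLeqI[of Inr]) auto
  then show "sets M = co_card_algebra ?\<kappa> (space M)"
    using co_card_algebra_discrete[OF ordLeq_ordLess_trans[OF _ big]] assms by blast
qed

lemma bij_invariant_imp_cocardinal:
  assumes inv: "bij_invariant M"
  shows "cocardinal M"
proof (cases "sets M = {{}, space M} \<or> sets M = Pow (space M)")
  case True
  then show ?thesis
    using cocardinal_trivial cocardinal_discrete by blast
next
  case False
  then obtain B0 where "B0 \<subseteq> space M \<and> B0 \<notin> sets M"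
    using sets.sets_into_space by blast
  then obtain B where B: "B \<subseteq> space M" "B \<notin> sets M"
    and min: "\<And>A. |A| <o |B| \<Longrightarrow> \<not> (A \<subseteq> space M \<and> A \<notin> sets M)"
    using minimal_cardinality[of "\<lambda>B. B \<subseteq> space M \<and> B \<notin> sets M"] by metis
  \<comment> \<open>Hence \<open>|B|\<close> lies above \<open>natLeq\<close>, outside the excluded
    range.\<close>
  have unc: "\<not> countable B"
    using bij_invariant_countable[OF inv] False B by blast
  show ?thesis
  proof (rule cocardinalI)
    have "\<not> |B| \<le>o |UNIV :: nat set|"
      using unc by (auto simp: countable_def card_of_ordLeq[symmetric])
    then have "\<not> |B| \<le>o natLeq"
      using ordLeq_ordIso_trans[OF _ ordIso_symmetric[OF card_of_nat]] by blast
    then show "admissible_cardinal |B|"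
      by (simp add: admissible_cardinal_def card_of_Card_order)
    have "infinite B"
      using unc countable_finite by blast
    then have "|A| <o |B| \<or> |space M - A| <o |B|" if "A \<in> sets M" for A
      using bij_invariant_imp_small[OF inv B] that by blast
    moreover have "A \<in> sets M" if "A \<subseteq> space M" "|A| <o |B| \<or> |space M - A| <o |B|" for A
    proof -
      \<comment> \<open>By minimality of \<open>|B|\<close>, whichever of the two sets is smaller
        than \<open>B\<close> is measurable.\<close>
      have "A \<in> sets M \<or> space M - A \<in> sets M"
        using min that by blast
      then show ?thesis
        using sets.compl_sets[of "space M - A" M] that(1) by (auto simp: double_diff)
    qed
    ultimately show "sets M = co_card_algebra |B| (space M)"
      unfolding co_card_algebra_def using sets.sets_into_space by blast
  qed
qed

theorem theorem2:
  fixes M :: "'a measure"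
  shows "Iso M = Bij (space M) \<longleftrightarrow> cocardinal M"
  unfolding Iso_eq_Bij_iff_bij_invariant
  using bij_invariant_imp_cocardinal cocardinal_imp_bij_invariant by blast

end
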